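(* Let $R$ be a dedekind type domain having infinitely many maximal ideals, let $\mathit{M}(R)$ be the monoid generated by the maximal ideals of $R$, let $\mathcal{I}_1,\dots,\mathcal{I}_r\in\mathit{M}(R)$ be pairwise comaximal, and let $k\ge2$ with $r\le k$. Let $G_{r,k}(R)$ be the set of $r\times k$ matrices $A=[a_{ij}]$ over $R$ whose $r\times r$ minors generate the unit ideal. Then the map $\tau:G_{r,k}(R)\to\mathbb{PF}^{k-1}_{\mathcal{I}_1}\times\cdots\times\mathbb{PF}^{k-1}_{\mathcal{I}_r}$, $\tau(A)=([a_{11}:\dots:a_{1k}],\dots,[a_{r1}:\dots:a_{rk}])$, is surjective.
   Context: Dedekind type domain: a commutative ring $R$ with unity which is a field, or in which every maximal ideal $\mathcal{M}$ satisfies $\mathcal{M}^i\neq\mathcal{M}^{i+1}$ ($i\ge0$), $\bigcap_{i\ge0}\mathcal{M}^i=(0)$, $\dim_{R/\mathcal{M}}\mathcal{M}^i/\mathcal{M}^{i+1}=1$ ($i\ge0$), and every nonzero element lies in only finitely many maximal ideals. $\mathit{M}(R)$ is the set of finite products of maximal ideals ($R$ the empty product). For an ideal $\mathcal{I}$, $\mathbb{PF}^{n}_{\mathcal{I}}$ is the set of unital tuples $(a_0,\dots,a_n)$ (generating $R$) modulo $(a_i)\sim(b_i)\iff a_ib_j-a_jb_i\in\mathcal{I}$ for all $i<j$; $[a_0:\dots:a_n]$ denotes the class. *)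

theory Defs
  imports
    "Jordan_Normal_Form.VS_Connect"
    "Jordan_Normal_Form.DL_Submatrix"
    "HOL-Algebra.Ideal_Product"
    "HOL-Algebra.QuotRing"
begin

text \<open>
  The ring is the type \<open>'a :: comm_ring_1\<close>; ideal theory is applied to it through
  \<open>class_ring\<close>, its view as a HOL-Algebra ring with carrier \<open>UNIV\<close>.
  Powers and products of ideals are those of the monoid \<open>ideals_set R\<close>, whose unit is
  \<open>carrier R\<close>; in particular \<open>M\<^sup>0 = R\<close>.
\<close>

abbreviation ideal_pow :: "('a, 'm) ring_scheme \<Rightarrow> 'a set \<Rightarrow> nat \<Rightarrow> 'a set" where
  "ideal_pow R M i \<equiv> M [^]\<^bsub>ideals_set R\<^esub> i"

text \<open>
  The \<open>R/M\<close>-vector space \<open>M\<^sup>i / M\<^sup>i\<^sup>+\<^sup>1\<close>. Its elements are the cosets \<open>M\<^sup>i\<^sup>+\<^sup>1 + x\<close>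
  with \<open>x \<in> M\<^sup>i\<close>, and \<open>(M + a) \<cdot> (M\<^sup>i\<^sup>+\<^sup>1 + x) = M\<^sup>i\<^sup>+\<^sup>1 + a x\<close>. The fields \<open>mult\<close> and
  \<open>one\<close> are present only because module records extend ring records.
\<close>

definition ideal_pow_quot ::
    "('a, 'm) ring_scheme \<Rightarrow> 'a set \<Rightarrow> nat \<Rightarrow> ('a set, 'a set) module" where
  "ideal_pow_quot R M i =
    (let J = ideal_pow R M (Suc i) in
      \<lparr> carrier = (\<lambda>x. J +>\<^bsub>R\<^esub> x) ` ideal_pow R M i,
        monoid.mult = rcoset_mult R J,
        one = J +>\<^bsub>R\<^esub> \<one>\<^bsub>R\<^esub>,
        zero = J,
        add = set_add R,
        module.smult = rcoset_mult R J \<rparr>)"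

lemma vectorspace_ideal_pow_quot:
  assumes "cring R" "maximalideal M R"
  shows "vectorspace (R Quot M) (ideal_pow_quot R M i)"
proof -
  interpret R: cring R by fact
  interpret MM: maximalideal M R by fact
  interpret IS: comm_monoid "ideals_set R" by (rule R.ideals_set_is_comm_monoid)
  define J where "J = ideal_pow R M (Suc i)"
  define N where "N = ideal_pow R M i"
  have Mc: "M \<in> carrier (ideals_set R)" by (simp add: ideals_set_def MM.is_ideal)
  have Ni: "ideal N R" using IS.nat_pow_closed[OF Mc, of i] by (simp add: N_def ideals_set_def)
  have Ji: "ideal J R" using IS.nat_pow_closed[OF Mc, of "Suc i"] by (simp add: J_def ideals_set_def del: monoid.nat_pow_Suc nat_pow_Suc)
  interpret N: ideal N R by (rule Ni)
  interpret J: ideal J R by (rule Ji)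
  have JN: "J = ideal_prod R N M" by (simp add: J_def N_def ideals_set_def)
  have sub: "J \<subseteq> N" unfolding JN using R.ideal_prod_inter[OF Ni MM.is_ideal] by auto
  have MN: "m \<otimes>\<^bsub>R\<^esub> x \<in> J" if "m \<in> M" "x \<in> N" for m x
    unfolding JN using ideal_prod.prod[of x N m M R] that by (simp add: R.m_comm N.Icarr MM.Icarr)
  have eqc: "J +>\<^bsub>R\<^esub> y = J +>\<^bsub>R\<^esub> x" if "y \<in> J +>\<^bsub>R\<^esub> x" "x \<in> carrier R" for x y
    using abelian_subgroup.a_repr_independence'[OF abelian_subgroupI3[OF J.additive_subgroup_axioms R.abelian_group_axioms] that] by simp
  have inN: "x \<in> carrier R" if "x \<in> N" for x using that by (rule N.Icarr)
  have sm: "rcoset_mult R J (M +>\<^bsub>R\<^esub> a) (J +>\<^bsub>R\<^esub> x) = J +>\<^bsub>R\<^esub> (a \<otimes>\<^bsub>R\<^esub> x)"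
    if a: "a \<in> carrier R" and x: "x \<in> N" for a x
  proof -
    have "J +>\<^bsub>R\<^esub> (b \<otimes>\<^bsub>R\<^esub> y) = J +>\<^bsub>R\<^esub> (a \<otimes>\<^bsub>R\<^esub> x)" if b: "b \<in> M +>\<^bsub>R\<^esub> a" and y: "y \<in> J +>\<^bsub>R\<^esub> x" for b y
    proof -
      obtain m where m: "m \<in> M" "b = m \<oplus>\<^bsub>R\<^esub> a" using b by (auto simp: a_r_coset_def')
      obtain j where j: "j \<in> J" "y = j \<oplus>\<^bsub>R\<^esub> x" using y by (auto simp: a_r_coset_def')
      have c: "m \<in> carrier R" "j \<in> carrier R" "x \<in> carrier R" using m j x MM.Icarr J.Icarr N.Icarr by auto
      have e: "b \<otimes>\<^bsub>R\<^esub> y = (m \<otimes>\<^bsub>R\<^esub> j \<oplus>\<^bsub>R\<^esub> m \<otimes>\<^bsub>R\<^esub> x \<oplus>\<^bsub>R\<^esub> a \<otimes>\<^bsub>R\<^esub> j) \<oplus>\<^bsub>R\<^esub> a \<otimes>\<^bsub>R\<^esub> x"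
        using m j c a by (simp add: R.l_distr R.r_distr R.a_ac)
      have "m \<otimes>\<^bsub>R\<^esub> j \<oplus>\<^bsub>R\<^esub> m \<otimes>\<^bsub>R\<^esub> x \<oplus>\<^bsub>R\<^esub> a \<otimes>\<^bsub>R\<^esub> j \<in> J"
        using MN[OF m(1) x] J.I_l_closed[OF j(1)] c a by (intro J.a_closed) auto
      hence "b \<otimes>\<^bsub>R\<^esub> y \<in> J +>\<^bsub>R\<^esub> (a \<otimes>\<^bsub>R\<^esub> x)" unfolding e by (auto simp: a_r_coset_def')
      thus ?thesis using eqc a c by blast
    qed
    moreover have "a \<in> M +>\<^bsub>R\<^esub> a" using a MM.a_rcos_self by blast
    moreover have "x \<in> J +>\<^bsub>R\<^esub> x" using x inN J.a_rcos_self by blast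
    ultimately show ?thesis unfolding rcoset_mult_def by blast
  qed
  let ?V = "ideal_pow_quot R M i"
  have V: "carrier ?V = (\<lambda>x. J +>\<^bsub>R\<^esub> x) ` N" "zero ?V = J" "add ?V = set_add R" "module.smult ?V = rcoset_mult R J"
    by (simp_all add: ideal_pow_quot_def J_def N_def Let_def)
  have Q: "carrier (R Quot M) = (\<lambda>x. M +>\<^bsub>R\<^esub> x) ` carrier R" "add (R Quot M) = set_add R" "monoid.mult (R Quot M) = rcoset_mult R M"
    "one (R Quot M) = M +>\<^bsub>R\<^esub> \<one>\<^bsub>R\<^esub>"
    by (auto simp: FactRing_def A_RCOSETS_def')
  have ad: "set_add R (J +>\<^bsub>R\<^esub> x) (J +>\<^bsub>R\<^esub> y) = J +>\<^bsub>R\<^esub> (x \<oplus>\<^bsub>R\<^esub> y)" if "x \<in> N" "y \<in> N" for x y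
    using J.a_rcos_sum that inN by auto
  have adM: "set_add R (M +>\<^bsub>R\<^esub> x) (M +>\<^bsub>R\<^esub> y) = M +>\<^bsub>R\<^esub> (x \<oplus>\<^bsub>R\<^esub> y)" if "x \<in> carrier R" "y \<in> carrier R" for x y
    using MM.a_rcos_sum that by auto
  have muM: "rcoset_mult R M (M +>\<^bsub>R\<^esub> x) (M +>\<^bsub>R\<^esub> y) = M +>\<^bsub>R\<^esub> (x \<otimes>\<^bsub>R\<^esub> y)" if "x \<in> carrier R" "y \<in> carrier R" for x y
    using MM.rcoset_mult_add that by auto
  have J0: "J = J +>\<^bsub>R\<^esub> \<zero>\<^bsub>R\<^esub>" by (simp add: J.a_rcos_const)
  have z: "\<zero>\<^bsub>R\<^esub> \<in> N" by simp
  have cl: "a \<otimes>\<^bsub>R\<^esub> x \<in> N" if "a \<in> carrier R" "x \<in> N" for a x using N.I_l_closed that by auto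
  have ab: "abelian_group ?V"
  proof (rule abelian_groupI)
    show "\<zero>\<^bsub>?V\<^esub> \<in> carrier ?V" unfolding V using J0 z by blast
    show "\<exists>y\<in>carrier ?V. y \<oplus>\<^bsub>?V\<^esub> x = \<zero>\<^bsub>?V\<^esub>" if "x \<in> carrier ?V" for x
    proof -
      from that obtain u where u: "u \<in> N" "x = J +>\<^bsub>R\<^esub> u" unfolding V by auto
      have "set_add R (J +>\<^bsub>R\<^esub> (\<ominus>\<^bsub>R\<^esub> u)) (J +>\<^bsub>R\<^esub> u) = J" using ad[of "\<ominus>\<^bsub>R\<^esub> u" u] u inN J0 by (simp add: R.l_neg)
      thus ?thesis unfolding V u using N.a_inv_closed[OF u(1)] by blast
    qed
    show "\<zero>\<^bsub>?V\<^esub> \<oplus>\<^bsub>?V\<^esub> x = x" if "x \<in> carrier ?V" for x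
    proof -
      from that obtain u where u: "u \<in> N" "x = J +>\<^bsub>R\<^esub> u" unfolding V by auto
      show ?thesis unfolding V u using ad[OF z u(1)] J0 inN[OF u(1)] by simp
    qed
  qed (auto simp: V ad inN R.a_ac)
  have fld: "field (R Quot M)" using MM.quotient_is_field assms by blast
  have "Module.module (R Quot M) ?V"
  proof (rule Module.moduleI)
    show "cring (R Quot M)" using fld by (simp add: field_def domain_def)
    show "abelian_group ?V" by (rule ab)
  qed (auto simp: V Q sm cl ad adM muM inN R.l_distr R.r_distr R.m_assoc)
  thus ?thesis using fld by (simp add: vectorspace_def)
qed

text \<open>
  Finite-dimensionality is demanded separately because \<open>vectorspace.dim\<close> is unspecified
  on spaces of infinite dimension.
\<close>

definition dedekind_type_domain :: "('a, 'm) ring_scheme \<Rightarrow> bool" where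
  "dedekind_type_domain R \<longleftrightarrow>
    cring R \<and>
    (field R \<or>
      ((\<forall>M. maximalideal M R \<longrightarrow>
          (\<forall>i. ideal_pow R M i \<noteq> ideal_pow R M (Suc i)) \<and>
          (\<Inter>i. ideal_pow R M i) = {\<zero>\<^bsub>R\<^esub>} \<and>
          (\<forall>i. vectorspace.fin_dim (R Quot M) (ideal_pow_quot R M i) \<and>
               vectorspace.dim (R Quot M) (ideal_pow_quot R M i) = 1)) \<and>
       (\<forall>x \<in> carrier R. x \<noteq> \<zero>\<^bsub>R\<^esub> \<longrightarrow> finite {M. maximalideal M R \<and> x \<in> M})))"

definition maximal_ideal_monoid :: "('a, 'm) ring_scheme \<Rightarrow> 'a set set" where
  "maximal_ideal_monoid R =
    {foldr (ideal_prod R) Ms (carrier R) | Ms. \<forall>M \<in> set Ms. maximalideal M R}"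

definition unital_tuples :: "nat \<Rightarrow> 'a :: comm_ring_1 vec set" where
  "unital_tuples n = {a \<in> carrier_vec (n + 1). Idl\<^bsub>class_ring\<^esub> (vec_set a) = UNIV}"

definition PF_rel :: "nat \<Rightarrow> 'a :: comm_ring_1 set \<Rightarrow> ('a vec \<times> 'a vec) set" where
  "PF_rel n I =
    {(a, b). a \<in> unital_tuples n \<and> b \<in> unital_tuples n \<and>
      (\<forall>i j. i < j \<and> j \<le> n \<longrightarrow> a $ i * b $ j - a $ j * b $ i \<in> I)}"

definition PF :: "nat \<Rightarrow> 'a :: comm_ring_1 set \<Rightarrow> 'a vec set set" where
  "PF n I = unital_tuples n // PF_rel n I"

definition PF_class :: "nat \<Rightarrow> 'a :: comm_ring_1 set \<Rightarrow> 'a vec \<Rightarrow> 'a vec set" where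
  "PF_class n I a = PF_rel n I `` {a}"

definition maximal_minors :: "nat \<Rightarrow> nat \<Rightarrow> 'a :: comm_ring_1 mat \<Rightarrow> 'a set" where
  "maximal_minors r k A = {det (submatrix A {..<r} J) | J. J \<subseteq> {..<k} \<and> card J = r}"

definition G_mat :: "nat \<Rightarrow> nat \<Rightarrow> 'a :: comm_ring_1 mat set" where
  "G_mat r k = {A \<in> carrier_mat r k. Idl\<^bsub>class_ring\<^esub> (maximal_minors r k A) = UNIV}"

text \<open>Rows are indexed by \<open>0, \<dots>, r - 1\<close>; an element of the product of the \<open>PF\<close> is an
  extensional function on \<open>{..<r}\<close>.\<close>

definition tau ::
    "nat \<Rightarrow> nat \<Rightarrow> (nat \<Rightarrow> 'a :: comm_ring_1 set) \<Rightarrow> 'a mat \<Rightarrow> nat \<Rightarrow> 'a vec set" where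
  "tau r k \<I> A = (\<lambda>i\<in>{..<r}. PF_class (k - 1) (\<I> i) (row A i))"

end

theory Submission
  imports Defs
begin

text \<open>
  Write \<open>a\<^sub>i\<close> for representatives of the given classes. A \<open>k \<times> k\<close> matrix of determinant 1 whose
  \<open>i\<close>-th row is congruent to \<open>a\<^sub>i\<close> modulo \<open>\<I> i\<close> is built from the identity matrix by column
  transvections, one row at a time. As \<open>\<I> i\<close> is a product of maximal ideals, the ring modulo \<open>\<I> i\<close>
  has stable rank 1, so transvections carry the \<open>i\<close>-th unit vector to \<open>a\<^sub>i\<close> modulo \<open>\<I> i\<close>.
  Multiplying their coefficients by some \<open>e \<equiv> 1\<close> modulo \<open>\<I> i\<close> lying in all the other \<open>\<I> j\<close> leaves
  the other rows unchanged modulo their ideals. By Laplace expansion along the last row,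
  the minors of the first \<open>n + 1\<close> rows lie in the ideal of those of the first \<open>n\<close> rows, so the
  first \<open>r\<close> rows have maximal minors generating the unit ideal.
\<close>

section \<open>Ideals and maximal ideals of the ring type\<close>

lemma
  assumes "ideal I (class_ring :: 'a :: comm_ring_1 ring)"
  shows ideal_zero_mem: "0 \<in> I"
    and ideal_add_mem: "x \<in> I \<Longrightarrow> y \<in> I \<Longrightarrow> x + y \<in> I"
    and ideal_mult_mem: "x \<in> I \<Longrightarrow> c * x \<in> I"
    and ideal_mult_mem_right: "x \<in> I \<Longrightarrow> x * c \<in> I"
    and ideal_uminus_mem: "x \<in> I \<Longrightarrow> - x \<in> I"
    and ideal_diff_mem: "x \<in> I \<Longrightarrow> y \<in> I \<Longrightarrow> x - y \<in> I"
proof -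
  interpret ideal I "class_ring :: 'a ring" by fact
  show z: "0 \<in> I" using zero_closed by simp
  show a: "x + y \<in> I" if "x \<in> I" "y \<in> I" for x y using a_closed[OF that] by simp
  show l: "c * x \<in> I" if "x \<in> I" for c x using I_l_closed[OF that, of c] by simp
  show "x * c \<in> I" if "x \<in> I" for c x using l[OF that, of c] by (simp add: mult.commute)
  show u: "- x \<in> I" if "x \<in> I" for x using l[OF that, of "-1"] by simp
  show "x - y \<in> I" if "x \<in> I" "y \<in> I" for x y using a[OF that(1) u[OF that(2)]] by simp
qed

lemma ideal_sum_mem:
  assumes I: "ideal I (class_ring :: 'a :: comm_ring_1 ring)" and "\<And>x. x \<in> S \<Longrightarrow> f x \<in> I"
  shows "sum f S \<in> I"
  using assms(2)
  by (induction S rule: infinite_finite_induct) (auto intro: ideal_zero_mem[OF I] ideal_add_mem[OF I])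

lemma ideal_dvd_mem:
  assumes "ideal I (class_ring :: 'a :: comm_ring_1 ring)" "x \<in> I" "x dvd y"
  shows "y \<in> I"
  using assms ideal_mult_mem_right by (auto elim!: dvdE)

lemma Idl_ideal: "ideal (Idl\<^bsub>class_ring\<^esub> S) (class_ring :: 'a :: comm_ring_1 ring)"
  by (rule ring.genideal_ideal[OF class_ring.ring_axioms]) simp

lemma Idl_superset: "S \<subseteq> Idl\<^bsub>class_ring\<^esub> (S :: 'a :: comm_ring_1 set)"
  by (rule ring.genideal_self[OF class_ring.ring_axioms]) simp

lemma Idl_minimal:
  "ideal I class_ring \<Longrightarrow> S \<subseteq> I \<Longrightarrow> Idl\<^bsub>class_ring\<^esub> S \<subseteq> (I :: 'a :: comm_ring_1 set)"
  by (rule ring.genideal_minimal[OF class_ring.ring_axioms])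

lemma maximal_imp_ideal: "maximalideal M R \<Longrightarrow> ideal M R"
  by (simp add: maximalideal_def)

lemma one_notin_maximal:
  assumes "maximalideal M (class_ring :: 'a :: comm_ring_1 ring)"
  shows "1 \<notin> M"
proof
  assume "1 \<in> M"
  then have "x \<in> M" for x
    using ideal_mult_mem[OF maximal_imp_ideal[OF assms], of 1 x] by simp
  then show False using maximalideal.I_notcarr[OF assms] by auto
qed

text \<open>The ideal M + (a) contains M strictly, so by maximality it contains 1.\<close>

lemma maximal_inverse:
  assumes M: "maximalideal M (class_ring :: 'a :: comm_ring_1 ring)" and a: "a \<notin> M"
  shows "\<exists>w. a * w - 1 \<in> M"
proof -
  note I = maximal_imp_ideal[OF M]
  define J where "J = M <+>\<^bsub>class_ring\<^esub> (PIdl\<^bsub>class_ring\<^esub> a)"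
  have J: "ideal J (class_ring :: 'a ring)"
    unfolding J_def
    by (intro ring.add_ideals[OF class_ring.ring_axioms] cring.cgenideal_ideal[OF class_cring.cring_axioms] I)
      simp
  have J_iff: "x \<in> J \<longleftrightarrow> (\<exists>m w. m \<in> M \<and> x = m + w * a)" for x
    by (auto simp: J_def set_add_def' cgenideal_def)
  have "M \<subseteq> J" unfolding J_iff subset_iff by (metis add.right_neutral mult_zero_left)
  moreover have "a \<in> J" unfolding J_iff using ideal_zero_mem[OF I] by (intro exI[of _ 0] exI[of _ 1]) simp
  ultimately have "J = UNIV" using maximalideal.I_maximal[OF M J] a by auto
  then obtain m w where "1 = m + w * a" "m \<in> M" using J_iff[of 1] by auto
  then have "a * w - 1 = - m" by (simp add: algebra_simps)
  then show ?thesis using ideal_uminus_mem[OF I \<open>m \<in> M\<close>] by metis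
qed

text \<open>If w inverts x modulo M, then y = x * y * w - (x * w - 1) * y, so x * y cannot lie in M
  without y.\<close>

lemma maximal_prime:
  assumes M: "maximalideal M (class_ring :: 'a :: comm_ring_1 ring)" and "x \<notin> M" "y \<notin> M"
  shows "x * y \<notin> M"
proof
  note I = maximal_imp_ideal[OF M]
  assume xy: "x * y \<in> M"
  obtain w where w: "x * w - 1 \<in> M" using maximal_inverse assms by blast
  have "x * y * w - (x * w - 1) * y \<in> M"
    by (intro ideal_diff_mem[OF I] ideal_mult_mem_right[OF I xy] ideal_mult_mem_right[OF I w])
  then show False using assms(3) by (simp add: algebra_simps)
qed

text \<open>Each N in the family contains an element outside M; the product of these elements lies
  in every N and stays outside M because M is prime.\<close>

lemma maximal_avoidance:
  assumes "finite \<M>" "\<And>N. N \<in> \<M> \<Longrightarrow> maximalideal N (class_ring :: 'a :: comm_ring_1 ring)"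
    and "maximalideal M (class_ring :: 'a ring)" "M \<notin> \<M>"
  shows "\<exists>y. y \<notin> M \<and> (\<forall>N\<in>\<M>. y \<in> N)"
  using assms(1,2,4)
proof (induction \<M> rule: finite_induct)
  case empty
  then show ?case using one_notin_maximal[OF assms(3)] by auto
next
  case (insert N \<M>)
  then obtain y where y: "y \<notin> M" "\<forall>N\<in>\<M>. y \<in> N" by auto
  have N: "maximalideal N (class_ring :: 'a ring)" using insert.prems by auto
  \<comment> \<open>By maximality of N, an inclusion in the proper ideal M would force N = M, but M
    is not in the family.\<close>
  have "\<not> N \<subseteq> M"
    using maximalideal.I_maximal[OF N maximal_imp_ideal[OF assms(3)]]
      maximalideal.I_notcarr[OF assms(3)] insert.prems by auto
  then obtain z where "z \<in> N" "z \<notin> M" by auto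
  have "z * y \<notin> M" using maximal_prime[OF assms(3)] \<open>z \<notin> M\<close> y by blast
  moreover have "z * y \<in> N" using ideal_mult_mem_right[OF maximal_imp_ideal[OF N]] \<open>z \<in> N\<close> by blast
  moreover have "z * y \<in> L" if "L \<in> \<M>" for L
    using y(2) that insert.prems(1)[of L] by (intro ideal_mult_mem maximal_imp_ideal) auto
  ultimately show ?case by blast
qed

section \<open>Stable range modulo products of maximal ideals\<close>

text \<open>The ideals are treated one at a time. If the current combination falls into the new
  ideal M, some \<open>a p\<close> with p in K is outside M, since otherwise \<open>a q\<close>
  would be in M as well. Adding \<open>y * a p\<close>, with y outside M but inside all earlier
  ideals, moves the value out of M and keeps its residues at the earlier ideals.\<close>

lemma stable_range_maximal:
  fixes a :: "'b \<Rightarrow> 'a :: comm_ring_1"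
  assumes "finite \<M>" "\<And>M. M \<in> \<M> \<Longrightarrow> maximalideal M (class_ring :: 'a ring)"
    and K: "finite K"
    and "\<And>M. M \<in> \<M> \<Longrightarrow> \<exists>p\<in>insert q K. a p \<notin> M"
  shows "\<exists>c. \<forall>M\<in>\<M>. a q + (\<Sum>p\<in>K. c p * a p) \<notin> M"
  using assms(1,2,4)
proof (induction \<M> rule: finite_induct)
  case empty
  then show ?case by auto
next
  case (insert M \<M>)
  then obtain c where c: "\<forall>M\<in>\<M>. a q + (\<Sum>p\<in>K. c p * a p) \<notin> M" by blast
  let ?u = "a q + (\<Sum>p\<in>K. c p * a p)"
  have M: "maximalideal M (class_ring :: 'a ring)" using insert.prems by auto
  note I = maximal_imp_ideal[OF M]
  show ?case
  proof (cases "?u \<in> M")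
    case False
    then show ?thesis using c by blast
  next
    case True
    have "\<exists>p\<in>K. a p \<notin> M"
    proof (rule ccontr)
      assume "\<not> ?thesis"
      then have "?u - (\<Sum>p\<in>K. c p * a p) \<in> M"
        using True by (intro ideal_diff_mem[OF I] ideal_sum_mem[OF I] ideal_mult_mem[OF I]) auto
      then have "a q \<in> M" by simp
      then show False using \<open>\<not> (\<exists>p\<in>K. a p \<notin> M)\<close> insert.prems(2)[of M] by auto
    qed
    then obtain p where p: "p \<in> K" "a p \<notin> M" by auto
    obtain y where y: "y \<notin> M" "\<forall>N\<in>\<M>. y \<in> N"
      using maximal_avoidance[OF insert.hyps(1) _ M insert.hyps(2)] insert.prems(1) by auto
    have eq: "a q + (\<Sum>p'\<in>K. (c(p := c p + y)) p' * a p') = ?u + y * a p"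
    proof -
      have "(\<Sum>p'\<in>K. (c(p := c p + y)) p' * a p') = (\<Sum>p'\<in>K. c p' * a p' + (if p' = p then y * a p' else 0))"
        by (intro sum.cong) (auto simp: algebra_simps)
      then show ?thesis using K p(1) by (simp add: sum.distrib sum.delta algebra_simps)
    qed
    have "?u + y * a p \<notin> M"
      using ideal_diff_mem[OF I _ True, of "?u + y * a p"] maximal_prime[OF M y(1) p(2)]
      by (metis add_diff_cancel_left')
    moreover have "?u + y * a p \<notin> N" if "N \<in> \<M>" for N
    proof
      assume "?u + y * a p \<in> N"
      have N: "ideal N (class_ring :: 'a ring)"
        using that insert.prems(1) by (auto intro: maximal_imp_ideal)
      then have "y * a p \<in> N" using y(2) that by (auto intro: ideal_mult_mem_right)
      with \<open>?u + y * a p \<in> N\<close> have "(?u + y * a p) - y * a p \<in> N"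
        by (rule ideal_diff_mem[OF N])
      then show False using c that by simp
    qed
    ultimately have "\<forall>N\<in>insert M \<M>. a q + (\<Sum>p'\<in>K. (c(p := c p + y)) p' * a p') \<notin> N"
      unfolding eq by blast
    then show ?thesis by blast
  qed
qed

lemma ideal_maximal_ideal_monoid:
  assumes "I \<in> maximal_ideal_monoid (class_ring :: 'a :: comm_ring_1 ring)"
  shows "ideal I (class_ring :: 'a ring)"
proof -
  have "ideal (foldr (ideal_prod class_ring) Ms UNIV) (class_ring :: 'a ring)"
    if "\<forall>M\<in>set Ms. maximalideal M (class_ring :: 'a ring)" for Ms
    using that
  proof (induction Ms)
    case Nil
    then show ?case using ring.oneideal[OF class_ring.ring_axioms] by simp
  next
    case (Cons M Ms)
    then show ?case
      using ring.ideal_prod_is_ideal[OF class_ring.ring_axioms maximal_imp_ideal, of M] by simp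
  qed
  then show ?thesis using assms by (auto simp: maximal_ideal_monoid_def)
qed

text \<open>Inverses w modulo M and v modulo the remaining product combine:
  \<open>(u * w - 1) * (u * v - 1)\<close> lies in the full product, and its negative has the form
  \<open>u * x - 1\<close>. Repeated factors are covered too.\<close>

lemma unit_mod_maximal_product:
  assumes "\<forall>M\<in>set Ms. maximalideal M (class_ring :: 'a :: comm_ring_1 ring) \<and> u \<notin> M"
  shows "\<exists>w. u * w - 1 \<in> foldr (ideal_prod (class_ring :: 'a ring)) Ms UNIV"
  using assms
proof (induction Ms)
  case Nil
  then show ?case by simp
next
  case (Cons M Ms)
  then obtain v where v: "u * v - 1 \<in> foldr (ideal_prod (class_ring :: 'a ring)) Ms UNIV" by auto
  obtain w where w: "u * w - 1 \<in> M" using maximal_inverse[of M u] Cons.prems by auto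
  let ?I = "foldr (ideal_prod (class_ring :: 'a ring)) (M # Ms) UNIV"
  have "?I \<in> maximal_ideal_monoid class_ring"
    unfolding maximal_ideal_monoid_def using Cons.prems by (intro CollectI exI[of _ "M # Ms"]) simp
  moreover have "(u * w - 1) * (u * v - 1) \<in> ?I"
    using ideal_prod.prod[OF w v, of class_ring] by simp
  ultimately have "- ((u * w - 1) * (u * v - 1)) \<in> ?I"
    by (intro ideal_uminus_mem ideal_maximal_ideal_monoid)
  moreover have "- ((u * w - 1) * (u * v - 1)) = u * (w + v - u * w * v) - 1"
    by (simp add: algebra_simps)
  ultimately have "u * (w + v - u * w * v) - 1 \<in> ?I" by argo
  then show ?case by blast
qed

text \<open>An element outside each of the finitely many maximal factors of \<open>I\<close> is a
  unit modulo \<open>I\<close>, so it is enough to keep one combination outside all of them.\<close>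

lemma stable_range_mod_maximal_product:
  fixes a :: "'b \<Rightarrow> 'a :: comm_ring_1"
  assumes "I \<in> maximal_ideal_monoid (class_ring :: 'a ring)" "finite K"
    and "\<And>M. maximalideal M (class_ring :: 'a ring) \<Longrightarrow> \<exists>p\<in>insert q K. a p \<notin> M"
  shows "\<exists>c w. (a q + (\<Sum>p\<in>K. c p * a p)) * w - 1 \<in> I"
proof -
  obtain Ms where Ms: "I = foldr (ideal_prod (class_ring :: 'a ring)) Ms UNIV"
    "\<forall>M\<in>set Ms. maximalideal M (class_ring :: 'a ring)"
    using assms(1) by (auto simp: maximal_ideal_monoid_def)
  have "\<exists>c. \<forall>M\<in>set Ms. a q + (\<Sum>p\<in>K. c p * a p) \<notin> M"
    using assms(3) Ms(2) by (intro stable_range_maximal assms(2)) auto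
  then obtain c where "\<forall>M\<in>set Ms. a q + (\<Sum>p\<in>K. c p * a p) \<notin> M" by blast
  then show ?thesis
    unfolding Ms(1) using Ms(2) by (intro exI[of _ c] unit_mod_maximal_product) auto
qed

section \<open>Transvections from unit vectors to unimodular vectors\<close>

text \<open>
  Transvections are invertible, so a property that they preserve can be transported from
  the unit vector at \<open>i\<close> to \<open>a\<close> by reducing \<open>a\<close> to that unit vector. One entry of \<open>a\<close> at a position
  \<open>q \<noteq> i\<close> is first made a unit modulo \<open>I\<close>, the entry at \<open>i\<close> is then made 1, and this 1 clears
  the other entries.
\<close>

lemma transvection_induct_unimodular:
  fixes a :: "nat \<Rightarrow> 'a :: comm_ring_1" and Q :: "(nat \<Rightarrow> 'a) \<Rightarrow> bool"
  assumes I: "I \<in> maximal_ideal_monoid (class_ring :: 'a ring)"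
    and unimodular: "\<And>M. maximalideal M (class_ring :: 'a ring) \<Longrightarrow> \<exists>p<k. a p \<notin> M"
    and k: "2 \<le> k" "i < k"
    and unit: "Q (\<lambda>j. if j = i then 1 else 0)"
    and cong: "\<And>v v'. Q v \<Longrightarrow> (\<And>j. j < k \<Longrightarrow> v j - v' j \<in> I) \<Longrightarrow> Q v'"
    and transvection: "\<And>v p q c. Q v \<Longrightarrow> p < k \<Longrightarrow> q < k \<Longrightarrow> p \<noteq> q \<Longrightarrow> Q (v(q := v q + c * v p))"
  shows "Q a"
proof -
  note idl = ideal_maximal_ideal_monoid[OF I]
  \<comment> \<open>The transvection with coefficient \<open>- c\<close> undoes the one with
    \<open>c\<close>, since p differs from q and so \<open>v p\<close> is unchanged.\<close>
  have pull_back: "Q v" if "Q (v(q := v q + c * v p))" "p < k" "q < k" "p \<noteq> q" for v p q c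
    using transvection[OF that, of "- c"] that(4) by simp
  \<comment> \<open>Many sources feed one target q. All sources differ from q, so each single
    transvection leaves the remaining summands as they were. In \<open>back_clear\<close> one source
    i feeds many targets, and the entry at i stays fixed.\<close>
  have back_sum: "Q v" if "finite S" "Q (v(q := v q + (\<Sum>p\<in>S. c p * v p)))" "S \<subseteq> {..<k} - {q}" "q < k"
    for v S q c
    using that
  proof (induction S arbitrary: v rule: finite_induct)
    case empty
    then show ?case by simp
  next
    case (insert p S)
    let ?v = "v(q := v q + c p * v p)"
    have "(\<Sum>p\<in>S. c p * ?v p) = (\<Sum>p\<in>S. c p * v p)"
      using insert.prems(2) by (intro sum.cong) auto
    then have eq: "?v(q := ?v q + (\<Sum>p\<in>S. c p * ?v p)) = v(q := v q + (\<Sum>p\<in>insert p S. c p * v p))"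
      by (simp only: fun_upd_same fun_upd_upd sum.insert[OF insert.hyps] add.assoc)
    have "Q ?v"
    proof (rule insert.IH)
      show "Q (?v(q := ?v q + (\<Sum>p\<in>S. c p * ?v p)))" unfolding eq by (rule insert.prems(1))
    qed (use insert.prems(2,3) in auto)
    then show ?case using insert.prems(2,3) by (intro pull_back[of v q "c p" p]) auto
  qed
  have back_clear: "Q v"
    if "finite S" "Q (\<lambda>j. if j \<in> S then v j + c j * v i else v j)" "S \<subseteq> {..<k} - {i}" for v S c
    using that
  proof (induction S arbitrary: v rule: finite_induct)
    case empty
    then show ?case by simp
  next
    case (insert p S)
    let ?v = "v(p := v p + c p * v i)"
    have eq: "(\<lambda>j. if j \<in> S then ?v j + c j * ?v i else ?v j)
        = (\<lambda>j. if j \<in> insert p S then v j + c j * v i else v j)"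
      using insert.prems(2) insert.hyps by auto
    have "Q ?v"
    proof (rule insert.IH)
      show "Q (\<lambda>j. if j \<in> S then ?v j + c j * ?v i else ?v j)" unfolding eq by (rule insert.prems(1))
    qed (use insert.prems(2) in auto)
    then show ?case using insert.prems(2) k by (intro pull_back[of v p "c p" i]) auto
  qed
  \<comment> \<open>One of 0 and 1 serves as q, because k is at least 2.\<close>
  obtain q where q: "q < k" "q \<noteq> i"
    using k that[of 0] that[of 1] by (cases "i = 0") auto
  have "\<exists>c w. (a q + (\<Sum>p\<in>{..<k} - {q}. c p * a p)) * w - 1 \<in> I"
  proof (rule stable_range_mod_maximal_product[OF I])
    show "\<exists>p\<in>insert q ({..<k} - {q}). a p \<notin> M" if "maximalideal M (class_ring :: 'a ring)" for M
      using unimodular[OF that] q by auto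
  qed auto
  then obtain c w where cw: "(a q + (\<Sum>p\<in>{..<k} - {q}. c p * a p)) * w - 1 \<in> I" by blast
  define v where "v = a(q := a q + (\<Sum>p\<in>{..<k} - {q}. c p * a p))"
  \<comment> \<open>As w inverts \<open>v q\<close> modulo \<open>I\<close>, the added term is
    congruent to \<open>1 - v i\<close>, which brings the entry at i to 1 modulo
    \<open>I\<close>.\<close>
  define v' where "v' = v(i := v i + (w * (1 - v i)) * v q)"
  have v'i: "v' i - 1 \<in> I"
  proof -
    have "v' i - 1 = (1 - v i) * (v q * w - 1)" by (simp add: v'_def algebra_simps)
    moreover have "v q * w - 1 \<in> I" using cw by (simp add: v_def)
    ultimately show ?thesis by (simp add: ideal_mult_mem[OF idl])
  qed
  \<comment> \<open>The entry at i is 1 only modulo \<open>I\<close>, so clearing leaves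
    \<open>v' j * (1 - v' i)\<close>, an element of \<open>I\<close>, at the other positions below
    k. Hence the unit vector is reached only up to congruence, which \<open>cong\<close>
    absorbs.\<close>
  have "Q (\<lambda>j. if j \<in> {..<k} - {i} then v' j + (- v' j) * v' i else v' j)"
  proof (rule cong[OF unit])
    fix j assume "j < k"
    have "0 - (v' j + (- v' j) * v' i) = v' j * (v' i - 1)" by (simp add: algebra_simps)
    then show "(if j = i then 1 else 0) - (if j \<in> {..<k} - {i} then v' j + (- v' j) * v' i else v' j) \<in> I"
      using ideal_mult_mem[OF idl v'i, of "v' j"] ideal_uminus_mem[OF idl v'i] \<open>j < k\<close> by auto
  qed
  then have "Q v'" by (rule back_clear[rotated]) auto
  then have "Q v" unfolding v'_def using q k by (intro pull_back[of v i "w * (1 - v i)" q]) auto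
  then show "Q a" unfolding v_def using q by (intro back_sum[of "{..<k} - {q}" a q c]) auto
qed

text \<open>The property carried along the transvections is the existence of a suitable M' whose row
  i is v modulo \<open>I\<close>. A transvection with coefficient b is realized on columns with
  coefficient \<open>e * b\<close>: the determinant is kept, every entry changes by a multiple of e,
  and in row i the factor e is invisible modulo \<open>I\<close>.\<close>

lemma replace_row_mod_ideal:
  fixes M :: "'a :: comm_ring_1 mat" and a :: "nat \<Rightarrow> 'a"
  assumes I: "I \<in> maximal_ideal_monoid (class_ring :: 'a ring)"
    and unimodular: "\<And>M. maximalideal M (class_ring :: 'a ring) \<Longrightarrow> \<exists>p<k. a p \<notin> M"
    and k: "2 \<le> k" "i < k"
    and M: "M \<in> carrier_mat k k" "det M = 1"
    and unit: "\<And>c. c < k \<Longrightarrow> M $$ (i, c) - (if c = i then 1 else 0) \<in> I"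
    and e: "e - 1 \<in> I"
  shows "\<exists>M'. M' \<in> carrier_mat k k \<and> det M' = 1
    \<and> (\<forall>j<k. \<forall>c<k. e dvd M' $$ (j, c) - M $$ (j, c)) \<and> (\<forall>c<k. M' $$ (i, c) - a c \<in> I)"
proof -
  note idl = ideal_maximal_ideal_monoid[OF I]
  show ?thesis
  proof (rule transvection_induct_unimodular[where a = a, OF I unimodular k])
    show "\<exists>M'. M' \<in> carrier_mat k k \<and> det M' = 1
      \<and> (\<forall>j<k. \<forall>c<k. e dvd M' $$ (j, c) - M $$ (j, c))
      \<and> (\<forall>c<k. M' $$ (i, c) - (if c = i then 1 else 0) \<in> I)"
      using M unit by (intro exI[of _ M]) auto
  next
    fix v v' :: "nat \<Rightarrow> 'a"
    assume "\<exists>M'. M' \<in> carrier_mat k k \<and> det M' = 1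
      \<and> (\<forall>j<k. \<forall>c<k. e dvd M' $$ (j, c) - M $$ (j, c)) \<and> (\<forall>c<k. M' $$ (i, c) - v c \<in> I)"
    then obtain M' where M': "M' \<in> carrier_mat k k" "det M' = 1"
      "\<forall>j<k. \<forall>c<k. e dvd M' $$ (j, c) - M $$ (j, c)" "\<forall>c<k. M' $$ (i, c) - v c \<in> I"
      by blast
    assume v': "\<And>j. j < k \<Longrightarrow> v j - v' j \<in> I"
    have "M' $$ (i, c) - v' c \<in> I" if "c < k" for c
      using ideal_add_mem[OF idl M'(4)[rule_format, OF that] v'[OF that]] by simp
    then show "\<exists>M'. M' \<in> carrier_mat k k \<and> det M' = 1
      \<and> (\<forall>j<k. \<forall>c<k. e dvd M' $$ (j, c) - M $$ (j, c)) \<and> (\<forall>c<k. M' $$ (i, c) - v' c \<in> I)"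
      using M' by blast
  next
    fix v :: "nat \<Rightarrow> 'a" and p q b
    assume "\<exists>M'. M' \<in> carrier_mat k k \<and> det M' = 1
      \<and> (\<forall>j<k. \<forall>c<k. e dvd M' $$ (j, c) - M $$ (j, c)) \<and> (\<forall>c<k. M' $$ (i, c) - v c \<in> I)"
    then obtain M' where M': "M' \<in> carrier_mat k k" "det M' = 1"
      "\<forall>j<k. \<forall>c<k. e dvd M' $$ (j, c) - M $$ (j, c)" "\<forall>c<k. M' $$ (i, c) - v c \<in> I"
      by blast
    assume pq: "p < k" "q < k" "p \<noteq> q"
    let ?N = "addcol (e * b) q p M'"
    have "?N \<in> carrier_mat k k" using M' by auto
    moreover have "det ?N = 1" using det_addcol[OF pq(1) _ M'(1), of q "e * b"] pq M'(2) by simp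
    moreover have "e dvd ?N $$ (j, c) - M $$ (j, c)" if "j < k" "c < k" for j c
    proof (cases "c = q")
      case True
      have "e dvd e * (b * M' $$ (j, p)) + (M' $$ (j, q) - M $$ (j, q))"
        using M'(3) that True by (intro dvd_add) auto
      then show ?thesis using True that M'(1) pq by (simp add: algebra_simps)
    next
      case False
      then show ?thesis using M' that pq by auto
    qed
    moreover have "?N $$ (i, c) - (v(q := v q + b * v p)) c \<in> I" if "c < k" for c
    proof (cases "c = q")
      case True
      \<comment> \<open>This is the new entry minus its target, regrouped into the old errors at p
        and q and the error \<open>e - 1\<close> of using \<open>e * b\<close> for b.\<close>
      have "e * b * (M' $$ (i, p) - v p) + (M' $$ (i, q) - v q) + b * v p * (e - 1) \<in> I"
        using M'(4) pq e by (intro ideal_add_mem[OF idl] ideal_mult_mem[OF idl]) auto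
      then show ?thesis using True M'(1) pq k by (simp add: algebra_simps)
    next
      case False
      then show ?thesis using M' that pq k by auto
    qed
    ultimately show "\<exists>M'. M' \<in> carrier_mat k k \<and> det M' = 1
      \<and> (\<forall>j<k. \<forall>c<k. e dvd M' $$ (j, c) - M $$ (j, c))
      \<and> (\<forall>c<k. M' $$ (i, c) - (v(q := v q + b * v p)) c \<in> I)"
      by blast
  qed
qed

section \<open>Lifting all rows simultaneously\<close>

text \<open>Chinese remaindering: for each j, comaximality gives an element of \<open>\<I> j\<close>
  congruent to 1 modulo \<open>I\<close>, and e is the product of these elements.\<close>

lemma comaximal_idempotent:
  fixes \<I> :: "'i \<Rightarrow> 'a :: comm_ring_1 set"
  assumes "finite S" "ideal I (class_ring :: 'a ring)"
    and "\<And>j. j \<in> S \<Longrightarrow> ideal (\<I> j) (class_ring :: 'a ring)"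
    and "\<And>j. j \<in> S \<Longrightarrow> I <+>\<^bsub>class_ring\<^esub> \<I> j = UNIV"
  shows "\<exists>e. e - 1 \<in> I \<and> (\<forall>j\<in>S. e \<in> \<I> j)"
  using assms(1,3,4)
proof (induction S rule: finite_induct)
  case empty
  then show ?case using ideal_zero_mem[OF assms(2)] by (intro exI[of _ 1]) auto
next
  case (insert j S)
  then obtain e where e: "e - 1 \<in> I" "\<forall>j\<in>S. e \<in> \<I> j" by auto
  have "1 \<in> I <+>\<^bsub>class_ring\<^esub> \<I> j" using insert.prems by auto
  then obtain x y where xy: "1 = x + y" "x \<in> I" "y \<in> \<I> j" by (auto simp: set_add_def')
  have "e * y - 1 = (e - 1) * y - x" using xy(1) by (simp add: algebra_simps)
  then have "e * y - 1 \<in> I"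
    using e(1) xy(2) ideal_diff_mem[OF assms(2)] ideal_mult_mem_right[OF assms(2)] by simp
  moreover have "e * y \<in> \<I> j'" if "j' \<in> insert j S" for j'
    using that e(2) xy(3) insert.prems(1) by (auto intro: ideal_mult_mem ideal_mult_mem_right)
  ultimately show ?case by blast
qed

lemma unimodular_rows_lift:
  fixes a :: "nat \<Rightarrow> nat \<Rightarrow> 'a :: comm_ring_1"
  assumes \<I>: "\<And>i. i < r \<Longrightarrow> \<I> i \<in> maximal_ideal_monoid (class_ring :: 'a ring)"
    and comax: "\<And>i j. i < r \<Longrightarrow> j < r \<Longrightarrow> i \<noteq> j \<Longrightarrow> \<I> i <+>\<^bsub>class_ring\<^esub> \<I> j = UNIV"
    and unimodular: "\<And>i M. i < r \<Longrightarrow> maximalideal M (class_ring :: 'a ring) \<Longrightarrow> \<exists>p<k. a i p \<notin> M"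
    and k: "2 \<le> k" "r \<le> k"
  shows "\<exists>M. M \<in> carrier_mat k k \<and> det M = 1 \<and> (\<forall>i<r. \<forall>c<k. M $$ (i, c) - a i c \<in> \<I> i)"
proof -
  have idl: "ideal (\<I> i) (class_ring :: 'a ring)" if "i < r" for i
    using ideal_maximal_ideal_monoid[OF \<I>[OF that]] .
  \<comment> \<open>Invariant: the first m rows are already correct, and the later rows below r are
    still unit vectors modulo their ideals, which is the starting point that
    \<open>replace_row_mod_ideal\<close> requires.\<close>
  have "\<exists>M. M \<in> carrier_mat k k \<and> det M = 1
      \<and> (\<forall>i<m. \<forall>c<k. M $$ (i, c) - a i c \<in> \<I> i)
      \<and> (\<forall>i. m \<le> i \<longrightarrow> i < r \<longrightarrow> (\<forall>c<k. M $$ (i, c) - (if c = i then 1 else 0) \<in> \<I> i))"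
    if "m \<le> r" for m
    using that
  proof (induction m)
    case 0
    have "(1\<^sub>m k :: 'a mat) $$ (i, c) - (if c = i then 1 else 0) \<in> \<I> i" if "i < r" "c < k" for i c
      using ideal_zero_mem[OF idl] that k by auto
    then show ?case by (intro exI[of _ "1\<^sub>m k"]) auto
  next
    case (Suc m)
    then obtain M where M: "M \<in> carrier_mat k k" "det M = 1"
      "\<forall>i<m. \<forall>c<k. M $$ (i, c) - a i c \<in> \<I> i"
      "\<forall>i. m \<le> i \<longrightarrow> i < r \<longrightarrow> (\<forall>c<k. M $$ (i, c) - (if c = i then 1 else 0) \<in> \<I> i)"
      by auto
    have m: "m < r" using Suc.prems by simp
    have "\<exists>e. e - 1 \<in> \<I> m \<and> (\<forall>j\<in>{..<r} - {m}. e \<in> \<I> j)"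
      using m comax idl by (intro comaximal_idempotent) auto
    then obtain e where e: "e - 1 \<in> \<I> m" "\<forall>j\<in>{..<r} - {m}. e \<in> \<I> j" by blast
    have "\<exists>M'. M' \<in> carrier_mat k k \<and> det M' = 1
        \<and> (\<forall>j<k. \<forall>c<k. e dvd M' $$ (j, c) - M $$ (j, c)) \<and> (\<forall>c<k. M' $$ (m, c) - a m c \<in> \<I> m)"
      using M m k e(1) by (intro replace_row_mod_ideal[OF \<I>[OF m] unimodular[OF m]]) auto
    then obtain M' where M': "M' \<in> carrier_mat k k" "det M' = 1"
      "\<forall>j<k. \<forall>c<k. e dvd M' $$ (j, c) - M $$ (j, c)" "\<forall>c<k. M' $$ (m, c) - a m c \<in> \<I> m"
      by blast
    \<comment> \<open>All entries change by multiples of e, and e lies in \<open>\<I> i\<close> for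
      every i other than m.\<close>
    have keep: "M' $$ (i, c) - x \<in> \<I> i"
      if "i < r" "i \<noteq> m" "c < k" "M $$ (i, c) - x \<in> \<I> i" for i c x
    proof -
      have "e \<in> \<I> i" using e(2) that(1,2) by simp
      moreover have "e dvd M' $$ (i, c) - M $$ (i, c)" using M'(3) that(1,3) k(2) by simp
      ultimately have "M' $$ (i, c) - M $$ (i, c) \<in> \<I> i"
        by (rule ideal_dvd_mem[OF idl[OF that(1)]])
      from ideal_add_mem[OF idl[OF that(1)] this that(4)] show ?thesis by simp
    qed
    have "M' $$ (i, c) - a i c \<in> \<I> i" if "i < Suc m" "c < k" for i c
      using keep[of i c "a i c"] M(3) M'(4) that m by (cases "i = m") auto
    moreover have "M' $$ (i, c) - (if c = i then 1 else 0) \<in> \<I> i" if "Suc m \<le> i" "i < r" "c < k" for i c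
      using keep[of i c] M(4) that by auto
    ultimately show ?case using M' by blast
  qed
  from this[of r] show ?thesis by auto
qed

section \<open>Submatrices and maximal minors\<close>

text \<open>An element of a set is picked at the index that counts the smaller elements. Removing
  the j-th element lowers this count by one exactly for the elements after it.\<close>

lemma pick_remove:
  assumes J: "finite J" and l: "Suc l < card J" and j: "j < card J"
  shows "pick (J - {pick J j}) l = pick J (if l < j then l else Suc l)"
proof -
  let ?l = "if l < j then l else Suc l"
  have l': "?l < card J" using l j by auto
  have "pick J ?l \<noteq> pick J j"
    using pick_mono[of j J ?l] pick_mono[of ?l J j] l' j by (cases "l < j") auto
  then have mem: "pick J ?l \<in> J - {pick J j}" using pick_in_set l' by auto
  have "card {a \<in> J - {pick J j}. a < pick J ?l} = l"
  proof (cases "l < j")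
    case True
    then have "pick J ?l < pick J j" using pick_mono j by auto
    then have "{a \<in> J - {pick J j}. a < pick J ?l} = {a \<in> J. a < pick J ?l}" by auto
    then show ?thesis using card_pick[of ?l J] l' True by simp
  next
    case False
    then have "pick J j < pick J ?l" using pick_mono[of ?l J j] l' by (simp del: pick.simps)
    moreover have "{a \<in> J - {pick J j}. a < pick J ?l} = {a \<in> J. a < pick J ?l} - {pick J j}" by auto
    ultimately show ?thesis using card_pick[of ?l J] l' False pick_in_set[of j J] j J by simp
  qed
  then show ?thesis using pick_card_in_set[OF mem] by simp
qed

lemma pick_lessThan: "l < n \<Longrightarrow> pick {..<n} l = l"
proof -
  assume "l < n"
  then have "{a \<in> {..<n}. a < l} = {..<l}" by auto
  then show ?thesis using pick_card_in_set[of l "{..<n}"] \<open>l < n\<close> by simp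
qed

lemma submatrix_carrier:
  assumes "A \<in> carrier_mat m k" "n \<le> m" "J \<subseteq> {..<k}"
  shows "submatrix A {..<n} J \<in> carrier_mat n (card J)"
proof -
  have "{i. i < m \<and> i \<in> {..<n}} = {..<n}" "{j. j < k \<and> j \<in> J} = J" using assms by auto
  then show ?thesis using assms(1) by (simp add: submatrix_def)
qed

lemma submatrix_lessThan_index:
  assumes "A \<in> carrier_mat m k" "n \<le> m" "J \<subseteq> {..<k}" "i < n" "j < card J"
  shows "submatrix A {..<n} J $$ (i, j) = A $$ (i, pick J j)"
proof -
  have "{i. i < m \<and> i \<in> {..<n}} = {..<n}" "{j. j < k \<and> j \<in> J} = J" using assms by auto
  then show ?thesis using assms by (simp add: submatrix_def pick_lessThan)
qed

text \<open>This identifies the minors in an expansion along the last row with maximal minors of the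
  first n rows.\<close>

lemma mat_delete_submatrix:
  assumes A: "A \<in> carrier_mat m k" "n < m" and J: "J \<subseteq> {..<k}" "card J = Suc n" and j: "j < Suc n"
  shows "mat_delete (submatrix A {..<Suc n} J) n j = submatrix A {..<n} (J - {pick J j})"
proof -
  have fin: "finite J" using J(1) finite_subset by auto
  have J': "J - {pick J j} \<subseteq> {..<k}" "card (J - {pick J j}) = n"
    using J fin pick_in_set[of j J] j by auto
  have B: "submatrix A {..<Suc n} J \<in> carrier_mat (Suc n) (Suc n)"
    using submatrix_carrier[of A m k "Suc n" J] assms by auto
  have C: "submatrix A {..<n} (J - {pick J j}) \<in> carrier_mat n n"
    using submatrix_carrier[of A m k n "J - {pick J j}"] assms J' by auto
  show ?thesis
  proof (rule eq_matI)
    fix p l assume "p < dim_row (submatrix A {..<n} (J - {pick J j}))"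
      "l < dim_col (submatrix A {..<n} (J - {pick J j}))"
    then have pl: "p < n" "l < n" using C by auto
    have "mat_delete (submatrix A {..<Suc n} J) n j $$ (p, l)
        = submatrix A {..<Suc n} J $$ (p, if l < j then l else Suc l)"
      using B pl by (simp add: mat_delete_def)
    also have "\<dots> = A $$ (p, pick J (if l < j then l else Suc l))"
      using assms pl by (intro submatrix_lessThan_index[OF A(1) _ J(1)]) auto
    also have "\<dots> = submatrix A {..<n} (J - {pick J j}) $$ (p, l)"
      using submatrix_lessThan_index[OF A(1) _ J'(1), of n p l] pick_remove[OF fin, of l j] A pl J j J'
      by simp
    finally show "mat_delete (submatrix A {..<Suc n} J) n j $$ (p, l)
      = submatrix A {..<n} (J - {pick J j}) $$ (p, l)" .
  qed (use B C in auto)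
qed

lemma maximal_minors_Suc_subset:
  fixes A :: "'a :: comm_ring_1 mat"
  assumes A: "A \<in> carrier_mat m k" "n < m"
  shows "maximal_minors (Suc n) k A \<subseteq> Idl\<^bsub>class_ring\<^esub> (maximal_minors n k A)"
proof
  fix x assume "x \<in> maximal_minors (Suc n) k A"
  then obtain J where J: "J \<subseteq> {..<k}" "card J = Suc n" and x: "x = det (submatrix A {..<Suc n} J)"
    by (auto simp: maximal_minors_def)
  let ?I = "Idl\<^bsub>class_ring\<^esub> (maximal_minors n k A)"
  let ?B = "submatrix A {..<Suc n} J"
  have I: "ideal ?I (class_ring :: 'a ring)" by (rule Idl_ideal)
  have B: "?B \<in> carrier_mat (Suc n) (Suc n)"
    using submatrix_carrier[of A m k "Suc n" J] A J by auto
  have "det (mat_delete ?B n j) \<in> ?I" if j: "j < Suc n" for j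
  proof -
    have "finite J" using J(1) finite_subset by auto
    then have "J - {pick J j} \<subseteq> {..<k}" "card (J - {pick J j}) = n"
      using J pick_in_set[of j J] j by auto
    then have "det (mat_delete ?B n j) \<in> maximal_minors n k A"
      unfolding mat_delete_submatrix[OF A J j] by (auto simp: maximal_minors_def)
    then show ?thesis using Idl_superset[of "maximal_minors n k A"] by auto
  qed
  \<comment> \<open>Row n is the last row of the submatrix; each cofactor is a sign times one of the
    minors just treated.\<close>
  then have "(\<Sum>j<Suc n. ?B $$ (n, j) * cofactor ?B n j) \<in> ?I"
    by (intro ideal_sum_mem[OF I] ideal_mult_mem[OF I]) (auto simp: cofactor_def intro: ideal_mult_mem[OF I])
  then show "x \<in> ?I" unfolding x using laplace_expansion_row[OF B, of n] by simp
qed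

text \<open>Descending induction on r from k, where \<open>det A = 1\<close> is itself a maximal
  minor.\<close>

lemma maximal_minors_det_one:
  fixes A :: "'a :: comm_ring_1 mat"
  assumes A: "A \<in> carrier_mat k k" "det A = 1" and "r \<le> k"
  shows "Idl\<^bsub>class_ring\<^esub> (maximal_minors r k A) = UNIV"
  using assms(3)
proof (induction r rule: inc_induct)
  case base
  have "submatrix A {..<k} {..<k} = A"
  proof (rule eq_matI)
    show "submatrix A {..<k} {..<k} $$ (i, j) = A $$ (i, j)" if "i < dim_row A" "j < dim_col A" for i j
      using submatrix_lessThan_index[OF A(1), of k "{..<k}" i j] that A(1) by (simp add: pick_lessThan)
  qed (use submatrix_carrier[OF A(1), of k "{..<k}"] A(1) in auto)
  then have "1 \<in> maximal_minors k k A"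
    using A(2) by (auto simp: maximal_minors_def intro!: exI[of _ "{..<k}"])
  then have one: "1 \<in> Idl\<^bsub>class_ring\<^esub> (maximal_minors k k A)"
    using Idl_superset[of "maximal_minors k k A"] by auto
  have I: "ideal (Idl\<^bsub>class_ring\<^esub> (maximal_minors k k A)) (class_ring :: 'a ring)"
    by (rule Idl_ideal)
  show ?case using ideal_mult_mem[OF I one] by auto
next
  case (step n)
  have "Idl\<^bsub>class_ring\<^esub> (maximal_minors (Suc n) k A) \<subseteq> Idl\<^bsub>class_ring\<^esub> (maximal_minors n k A)"
    using maximal_minors_Suc_subset[OF A(1) step.hyps(2)]
    by (intro Idl_minimal Idl_ideal) auto
  then show ?case using step.IH by auto
qed

text \<open>Laplace expansion along row i writes each maximal minor as a combination of entries of
  that row. Hence the rows of a matrix in \<open>G_mat\<close> are unital.\<close>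

lemma maximal_minors_subset_row_ideal:
  fixes A :: "'a :: comm_ring_1 mat"
  assumes A: "A \<in> carrier_mat r k" and i: "i < r"
  shows "maximal_minors r k A \<subseteq> Idl\<^bsub>class_ring\<^esub> (vec_set (row A i))"
proof
  fix x assume "x \<in> maximal_minors r k A"
  then obtain J where J: "J \<subseteq> {..<k}" "card J = r" and x: "x = det (submatrix A {..<r} J)"
    by (auto simp: maximal_minors_def)
  let ?I = "Idl\<^bsub>class_ring\<^esub> (vec_set (row A i))"
  let ?B = "submatrix A {..<r} J"
  have I: "ideal ?I (class_ring :: 'a ring)" by (rule Idl_ideal)
  have B: "?B \<in> carrier_mat r r" using submatrix_carrier[OF A order_refl J(1)] J by auto
  have "?B $$ (i, j) \<in> ?I" if j: "j < r" for j
  proof -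
    have "pick J j < k" using J pick_in_set[of j J] j by auto
    then have "?B $$ (i, j) \<in> vec_set (row A i)"
      using submatrix_lessThan_index[OF A order_refl J(1) i, of j] J j A i
      by (auto simp: vec_set_def intro!: image_eqI[of _ _ "pick J j"])
    then show ?thesis using Idl_superset[of "vec_set (row A i)"] by auto
  qed
  then show "x \<in> ?I" unfolding x laplace_expansion_row[OF B i]
    by (intro ideal_sum_mem[OF I] ideal_mult_mem_right[OF I]) auto
qed

section \<open>Unital tuples and their classes\<close>

lemma G_mat_row_unital:
  assumes "A \<in> G_mat r k" "i < r" "0 < k"
  shows "row A i \<in> unital_tuples (k - 1)"
proof -
  have A: "A \<in> carrier_mat r k" "Idl\<^bsub>class_ring\<^esub> (maximal_minors r k A) = UNIV"
    using assms by (auto simp: G_mat_def)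
  have "Idl\<^bsub>class_ring\<^esub> (maximal_minors r k A) \<subseteq> Idl\<^bsub>class_ring\<^esub> (vec_set (row A i))"
    using maximal_minors_subset_row_ideal[OF A(1) assms(2)]
    by (intro Idl_minimal Idl_ideal) auto
  then show ?thesis using A assms by (auto simp: unital_tuples_def)
qed

text \<open>This turns unitality into the condition at each maximal ideal on which the stable range
  argument runs.\<close>

lemma unital_tuple_notin_maximal:
  fixes a :: "'a :: comm_ring_1 vec"
  assumes "a \<in> unital_tuples n" and M: "maximalideal M (class_ring :: 'a ring)"
  shows "\<exists>p<n + 1. a $ p \<notin> M"
proof (rule ccontr)
  assume "\<not> ?thesis"
  then have "vec_set a \<subseteq> M" using assms(1) by (auto simp: unital_tuples_def vec_set_def)
  then have "Idl\<^bsub>class_ring\<^esub> (vec_set a) \<subseteq> M"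
    using maximal_imp_ideal[OF M] by (intro Idl_minimal Idl_ideal) auto
  then show False using assms(1) one_notin_maximal[OF M] by (auto simp: unital_tuples_def)
qed

text \<open>The expressions \<open>a $ i * c $ j - a $ j * c $ i\<close> are linear in a, so
  replacing a by a congruent b changes them by elements of \<open>I\<close>. The situation is
  symmetric in a and b, so one inclusion suffices.\<close>

lemma PF_class_cong:
  fixes a b :: "'a :: comm_ring_1 vec"
  assumes I: "ideal I (class_ring :: 'a ring)"
    and ab: "a \<in> unital_tuples n" "b \<in> unital_tuples n" "\<And>j. j \<le> n \<Longrightarrow> a $ j - b $ j \<in> I"
  shows "PF_class n I a = PF_class n I b"
proof -
  have "PF_class n I a \<subseteq> PF_class n I b"
    if "b \<in> unital_tuples n" and near: "\<And>j. j \<le> n \<Longrightarrow> a $ j - b $ j \<in> I" for a b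
  proof
    fix c assume "c \<in> PF_class n I a"
    then have c: "c \<in> unital_tuples n" "\<And>i j. i < j \<Longrightarrow> j \<le> n \<Longrightarrow> a $ i * c $ j - a $ j * c $ i \<in> I"
      by (auto simp: PF_class_def PF_rel_def)
    have "b $ i * c $ j - b $ j * c $ i \<in> I" if "i < j" "j \<le> n" for i j
    proof -
      have diff: "a $ i - b $ i \<in> I" "a $ j - b $ j \<in> I" using near that by auto
      have "(a $ i * c $ j - a $ j * c $ i) - ((a $ i - b $ i) * c $ j - (a $ j - b $ j) * c $ i) \<in> I"
        by (intro ideal_diff_mem[OF I] c(2)[OF that] diff[THEN ideal_mult_mem_right[OF I]])
      then show ?thesis by (simp add: algebra_simps)
    qed
    then show "c \<in> PF_class n I b" using c(1) that(1) by (auto simp: PF_class_def PF_rel_def)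
  qed
  from this[of a b] this[of b a] show ?thesis
    using ab ideal_uminus_mem[OF I] by (metis minus_diff_eq subset_antisym)
qed

section \<open>Values and surjectivity of \<open>tau\<close>\<close>

theorem mainTheorem13:
  fixes r k :: nat and \<I> :: "nat \<Rightarrow> 'a :: comm_ring_1 set"
  assumes "dedekind_type_domain (class_ring :: 'a ring)"
    and "infinite {M. maximalideal M (class_ring :: 'a ring)}"
    and "\<forall>i<r. \<I> i \<in> maximal_ideal_monoid class_ring"
    and "\<forall>i<r. \<forall>j<r. i \<noteq> j \<longrightarrow> \<I> i <+>\<^bsub>class_ring\<^esub> \<I> j = UNIV"
    and "k \<ge> 2"
    and "r \<le> k"
  shows "tau r k \<I> ` G_mat r k = (\<Pi>\<^sub>E i\<in>{..<r}. PF (k - 1) (\<I> i))"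
proof
  \<comment> \<open>This inclusion says that \<open>tau\<close> takes values in the product; the
    other one is surjectivity.\<close>
  have "PF_class (k - 1) (\<I> i) (row A i) \<in> PF (k - 1) (\<I> i)" if "A \<in> G_mat r k" "i < r" for A i
    using G_mat_row_unital[OF that] assms(5) by (auto simp: PF_class_def PF_def intro: quotientI)
  then show "tau r k \<I> ` G_mat r k \<subseteq> (\<Pi>\<^sub>E i\<in>{..<r}. PF (k - 1) (\<I> i))"
    by (auto simp: tau_def)
next
  show "(\<Pi>\<^sub>E i\<in>{..<r}. PF (k - 1) (\<I> i)) \<subseteq> tau r k \<I> ` G_mat r k"
  proof
    fix f assume f: "f \<in> (\<Pi>\<^sub>E i\<in>{..<r}. PF (k - 1) (\<I> i))"
    have "\<exists>a. a \<in> unital_tuples (k - 1) \<and> f i = PF_class (k - 1) (\<I> i) a" if "i < r" for i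
    proof -
      have "f i \<in> PF (k - 1) (\<I> i)" using f that by (auto simp: PiE_def)
      then show ?thesis by (auto simp: PF_def PF_class_def elim!: quotientE)
    qed
    then obtain a where a: "\<And>i. i < r \<Longrightarrow> a i \<in> unital_tuples (k - 1)"
      "\<And>i. i < r \<Longrightarrow> f i = PF_class (k - 1) (\<I> i) (a i)"
      by metis
    have "\<exists>M. M \<in> carrier_mat k k \<and> det M = 1 \<and> (\<forall>i<r. \<forall>c<k. M $$ (i, c) - a i $ c \<in> \<I> i)"
    proof (rule unimodular_rows_lift)
      show "\<exists>p<k. a i $ p \<notin> M" if "i < r" "maximalideal M (class_ring :: 'a ring)" for i M
        using unital_tuple_notin_maximal[OF a(1)[OF that(1)] that(2)] assms(5) by simp
    qed (use assms in auto)
    then obtain M where M: "M \<in> carrier_mat k k" "det M = 1"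
      "\<forall>i<r. \<forall>c<k. M $$ (i, c) - a i $ c \<in> \<I> i"
      by blast
    \<comment> \<open>The preimage consists of the first r rows of M, so A and M have the same
      maximal minors for these rows.\<close>
    define A where "A = mat r k (\<lambda>(i, j). M $$ (i, j))"
    have A: "A \<in> carrier_mat r k" by (simp add: A_def)
    have "submatrix A {..<r} J = submatrix M {..<r} J" if "J \<subseteq> {..<k}" for J
    proof (rule eq_matI)
      note B = submatrix_carrier[OF M(1) assms(6) that]
      note C = submatrix_carrier[OF A order_refl that]
      fix i j assume "i < dim_row (submatrix M {..<r} J)" "j < dim_col (submatrix M {..<r} J)"
      then have ij: "i < r" "j < card J" using B by auto
      then have "pick J j < k" using pick_in_set[of j J] that by auto
      then show "submatrix A {..<r} J $$ (i, j) = submatrix M {..<r} J $$ (i, j)"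
        using submatrix_lessThan_index[OF M(1) assms(6) that ij]
          submatrix_lessThan_index[OF A order_refl that ij] ij by (simp add: A_def)
    qed (use submatrix_carrier[OF M(1) assms(6) that] submatrix_carrier[OF A order_refl that] in auto)
    then have "maximal_minors r k A = maximal_minors r k M"
      unfolding maximal_minors_def by (intro Collect_cong ex_cong1) auto
    then have G: "A \<in> G_mat r k"
      using maximal_minors_det_one[OF M(1,2) assms(6)] A by (simp add: G_mat_def)
    have "tau r k \<I> A i = f i" for i
    proof (cases "i < r")
      case True
      have "PF_class (k - 1) (\<I> i) (row A i) = PF_class (k - 1) (\<I> i) (a i)"
      proof (rule PF_class_cong)
        show "ideal (\<I> i) (class_ring :: 'a ring)"
          using ideal_maximal_ideal_monoid assms(3) True by auto
        show "row A i $ j - a i $ j \<in> \<I> i" if "j \<le> k - 1" for j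
          using M(3) True that assms(5) by (simp add: A_def)
      qed (use G_mat_row_unital[OF G True] a(1)[OF True] assms(5) in auto)
      then show ?thesis using a(2) True by (simp add: tau_def)
    next
      \<comment> \<open>Both functions are extensional, hence \<open>undefined\<close> outside the
        index set.\<close>
      case False
      then show ?thesis using f by (auto simp: tau_def PiE_def extensional_def)
    qed
    then show "f \<in> tau r k \<I> ` G_mat r k" using G by (intro image_eqI[of _ _ A] ext) auto
  qed
qed

end
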